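(* (Indeterminacy.) There exists an $\mathit{MSO}[<]$ formula $\Psi(X,Y)$, with $X,Y$ monadic second-order variables, such that: (1) there is no C-operator $F$ such that $\mathit{FVsig}\models \forall X.\ \Psi(X,F(X))$; and (2) there is no SC-operator $G$ such that $\mathit{FVsig}\models \forall Y.\ \neg\Psi(G(Y),Y)$.
   Context: A (finitely variable) boolean signal is a function $f:\mathbb{R}^{\geq 0}\to\{0,1\}$ for which there is an unbounded strictly increasing sequence $0=\tau_0<\tau_1<\cdots$ of reals such that $f$ is constant on every open interval $(\tau_i,\tau_{i+1})$; a signal is identified with the subset of $\mathbb{R}^{\geq 0}$ where it is $1$. $\mathit{MSO}[<]$ is monadic second-order logic with atomic formulas $t<v$ and $X(t)$, boolean connectives, and first- and second-order quantifiers. $\mathit{FVsig}$ is the structure in which first-order variables range over $\mathbb{R}^{\geq 0}$ with its usual order and monadic second-order variables range over the finitely variable boolean signals. An operator is a function $F$ from signals to signals. $F$ is a C-operator (causal) if for every $t\geq 0$ and all signals $X_1,X_2$ that agree on $[0,t]$, $F(X_1)(t)=F(X_2)(t)$; $F$ is an SC-operator (strongly causal) if this holds whenever $X_1,X_2$ agree on $[0,t)$. *)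

theory Defs
  imports Complex_Main "HOL-Library.FuncSet"
begin

text \<open>A signal is represented by the subset of \<open>{0..}\<close> on which it takes the value 1.\<close>

definition signals :: "real set set" where
  "signals = {S. S \<subseteq> {0..} \<and>
     (\<exists>\<tau> :: nat \<Rightarrow> real. \<tau> 0 = 0 \<and> strict_mono \<tau> \<and> \<not> bdd_above (range \<tau>) \<and>
        (\<forall>i. \<exists>b. \<forall>t \<in> {\<tau> i<..<\<tau> (Suc i)}. (t \<in> S) = b))}"

text \<open>First-order and second-order variables are two separate sorts, each indexed by \<open>nat\<close>.\<close>

datatype mso =
    Less nat nat
  | Holds nat nat \<comment> \<open>\<open>Holds X t\<close> is the atom \<open>X(t)\<close>\<close>
  | Neg mso
  | Conj mso mso
  | Disj mso mso
  | Impl mso mso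
  | Ex1 nat mso
  | All1 nat mso
  | Ex2 nat mso
  | All2 nat mso

primrec free1 :: "mso \<Rightarrow> nat set" where
  "free1 (Less t v) = {t, v}"
| "free1 (Holds X t) = {t}"
| "free1 (Neg \<phi>) = free1 \<phi>"
| "free1 (Conj \<phi> \<psi>) = free1 \<phi> \<union> free1 \<psi>"
| "free1 (Disj \<phi> \<psi>) = free1 \<phi> \<union> free1 \<psi>"
| "free1 (Impl \<phi> \<psi>) = free1 \<phi> \<union> free1 \<psi>"
| "free1 (Ex1 t \<phi>) = free1 \<phi> - {t}"
| "free1 (All1 t \<phi>) = free1 \<phi> - {t}"
| "free1 (Ex2 X \<phi>) = free1 \<phi>"
| "free1 (All2 X \<phi>) = free1 \<phi>"

primrec free2 :: "mso \<Rightarrow> nat set" where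
  "free2 (Less t v) = {}"
| "free2 (Holds X t) = {X}"
| "free2 (Neg \<phi>) = free2 \<phi>"
| "free2 (Conj \<phi> \<psi>) = free2 \<phi> \<union> free2 \<psi>"
| "free2 (Disj \<phi> \<psi>) = free2 \<phi> \<union> free2 \<psi>"
| "free2 (Impl \<phi> \<psi>) = free2 \<phi> \<union> free2 \<psi>"
| "free2 (Ex1 t \<phi>) = free2 \<phi>"
| "free2 (All1 t \<phi>) = free2 \<phi>"
| "free2 (Ex2 X \<phi>) = free2 \<phi> - {X}"
| "free2 (All2 X \<phi>) = free2 \<phi> - {X}"

text \<open>Satisfaction in \<open>FVsig\<close> under a first-order assignment \<open>e\<close> and a second-order
  assignment \<open>E\<close>.\<close>

primrec sat :: "(nat \<Rightarrow> real) \<Rightarrow> (nat \<Rightarrow> real set) \<Rightarrow> mso \<Rightarrow> bool" where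
  "sat e E (Less t v) \<longleftrightarrow> e t < e v"
| "sat e E (Holds X t) \<longleftrightarrow> e t \<in> E X"
| "sat e E (Neg \<phi>) \<longleftrightarrow> \<not> sat e E \<phi>"
| "sat e E (Conj \<phi> \<psi>) \<longleftrightarrow> sat e E \<phi> \<and> sat e E \<psi>"
| "sat e E (Disj \<phi> \<psi>) \<longleftrightarrow> sat e E \<phi> \<or> sat e E \<psi>"
| "sat e E (Impl \<phi> \<psi>) \<longleftrightarrow> (sat e E \<phi> \<longrightarrow> sat e E \<psi>)"
| "sat e E (Ex1 t \<phi>) \<longleftrightarrow> (\<exists>r \<in> {0..}. sat (e(t := r)) E \<phi>)"
| "sat e E (All1 t \<phi>) \<longleftrightarrow> (\<forall>r \<in> {0..}. sat (e(t := r)) E \<phi>)"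
| "sat e E (Ex2 X \<phi>) \<longleftrightarrow> (\<exists>S \<in> signals. sat e (E(X := S)) \<phi>)"
| "sat e E (All2 X \<phi>) \<longleftrightarrow> (\<forall>S \<in> signals. sat e (E(X := S)) \<phi>)"

text \<open>A formula \<open>\<Psi>(X,Y)\<close> uses the second-order variables 0 and 1 for \<open>X\<close> and \<open>Y\<close> and has no
  other free variables; the values given to all other variables in \<open>sat2\<close> are therefore
  irrelevant.\<close>

definition formula2 :: "mso \<Rightarrow> bool" where
  "formula2 \<psi> \<longleftrightarrow> free1 \<psi> = {} \<and> free2 \<psi> \<subseteq> {0, 1}"

definition sat2 :: "mso \<Rightarrow> real set \<Rightarrow> real set \<Rightarrow> bool" where
  "sat2 \<psi> X Y \<longleftrightarrow> sat (\<lambda>_. 0) ((\<lambda>_. {})(0 := X, 1 := Y)) \<psi>"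

text \<open>Operators are only constrained on \<^term>\<open>signals\<close>; their values elsewhere are junk.\<close>

definition C_operator :: "(real set \<Rightarrow> real set) \<Rightarrow> bool" where
  "C_operator F \<longleftrightarrow> F \<in> signals \<rightarrow> signals \<and>
     (\<forall>t\<ge>0. \<forall>X1\<in>signals. \<forall>X2\<in>signals.
        (\<forall>s\<in>{0..t}. s \<in> X1 \<longleftrightarrow> s \<in> X2) \<longrightarrow> (t \<in> F X1 \<longleftrightarrow> t \<in> F X2))"

definition SC_operator :: "(real set \<Rightarrow> real set) \<Rightarrow> bool" where
  "SC_operator F \<longleftrightarrow> F \<in> signals \<rightarrow> signals \<and>
     (\<forall>t\<ge>0. \<forall>X1\<in>signals. \<forall>X2\<in>signals.
        (\<forall>s\<in>{0..<t}. s \<in> X1 \<longleftrightarrow> s \<in> X2) \<longrightarrow> (t \<in> F X1 \<longleftrightarrow> t \<in> F X2))"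

end

theory Submission
  imports Defs
begin

text \<open>The formula describes a race in which each player tries to move first at a positive time,
  with ties awarded to \<open>X\<close>. A player whose moves accumulate at 0 from the right is disqualified;
  if both are, \<open>X\<close> wins. Neither player has a winning strategy: run it against the empty signal.
  It must not be disqualified, so it makes no move on some interval \<open>(0,t)\<close>. Now let the opponent
  move once, at \<open>t/2\<close>. By causality the strategy still makes no move before \<open>t/2\<close>, and by strong
  causality \<open>X\<close> cannot even tie by moving at \<open>t/2\<close>. Hence the opponent wins.\<close>

definition eventually_empty_at_0 :: "real set \<Rightarrow> bool" where
  "eventually_empty_at_0 S \<longleftrightarrow> (\<exists>t>0. S \<inter> {0<..<t} = {})"

text \<open>The witness is any positive move of \<open>Y\<close> ahead of all positive moves of
  \<open>X\<close>; a first move need not exist, as for an open interval. Including \<open>s\<close>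
  in \<open>{0<..s}\<close> awards ties to \<open>X\<close>.\<close>

definition Y_wins_race :: "real set \<Rightarrow> real set \<Rightarrow> bool" where
  "Y_wins_race X Y \<longleftrightarrow> eventually_empty_at_0 Y \<and>
     (eventually_empty_at_0 X \<longrightarrow> (\<exists>s\<in>Y. 0 < s \<and> X \<inter> {0<..s} = {}))"

lemma eventually_empty_at_0_empty: "eventually_empty_at_0 {}"
  unfolding eventually_empty_at_0_def by (auto intro: exI[of _ 1])

lemma eventually_empty_at_0_singleton: "0 < a \<Longrightarrow> eventually_empty_at_0 {a}"
  unfolding eventually_empty_at_0_def by auto

lemma subset_singleton_in_signals:
  assumes "0 < a" and "S \<subseteq> {a}"
  shows "S \<in> signals"
proof -
  \<comment> \<open>Multiples of \<open>a\<close> place \<open>a\<close> at \<open>\<tau> 1\<close>,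
    so \<open>S\<close> misses every open piece.\<close>
  define \<tau> where "\<tau> i = real i * a" for i :: nat
  have "strict_mono \<tau>"
    using \<open>0 < a\<close> by (simp add: \<tau>_def strict_mono_def)
  moreover have "\<not> bdd_above (range \<tau>)"
  proof
    assume "bdd_above (range \<tau>)"
    then obtain M where M: "real i * a \<le> M" for i
      unfolding bdd_above_def \<tau>_def by auto
    obtain n where "M < real n * a"
      using ex_less_of_nat_mult[OF \<open>0 < a\<close>] by blast
    with M[of n] show False by simp
  qed
  moreover have "t \<notin> S" if "t \<in> {\<tau> i<..<\<tau> (Suc i)}" for t i
  proof
    assume "t \<in> S"
    then have "real i * a < 1 * a" "1 * a < real (Suc i) * a"
      using that \<open>S \<subseteq> {a}\<close> by (auto simp: \<tau>_def)
    then have "real i < 1" "1 < real (Suc i)"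
      using \<open>0 < a\<close> by (simp_all only: mult_less_cancel_right_pos)
    then show False by simp
  qed
  moreover have "\<tau> 0 = 0"
    by (simp add: \<tau>_def)
  ultimately show ?thesis
    using assms unfolding signals_def
    by (intro CollectI conjI exI[of _ \<tau>]) auto
qed

lemma no_C_operator_Y_wins_race:
  assumes "C_operator F"
  shows "\<exists>X\<in>signals. \<not> Y_wins_race X (F X)"
proof (rule ccontr)
  assume "\<not> ?thesis"
  then have wins: "Y_wins_race X (F X)" if "X \<in> signals" for X
    using that by blast
  have empty: "{} \<in> signals"
    by (rule subset_singleton_in_signals[of 1]) auto
  obtain t where t: "t > 0" "F {} \<inter> {0<..<t} = {}"
    using wins[OF empty] unfolding Y_wins_race_def eventually_empty_at_0_def by blast
  let ?X = "{t / 2}"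
  have X: "?X \<in> signals"
    using t by (intro subset_singleton_in_signals[of "t / 2"]) auto
  obtain s where s: "s \<in> F ?X" "0 < s" "?X \<inter> {0<..s} = {}"
    using wins[OF X] t eventually_empty_at_0_singleton[of "t / 2"]
    unfolding Y_wins_race_def by auto
  \<comment> \<open>Since a tie would go to \<open>X\<close>, the winning move precedes
    \<open>t / 2\<close>, where \<open>?X\<close> still looks empty.\<close>
  then have "s < t / 2"
    using t by auto
  then have "\<forall>r\<in>{0..s}. r \<in> ?X \<longleftrightarrow> r \<in> {}"
    by auto
  then have "s \<in> F ?X \<longleftrightarrow> s \<in> F {}"
    using assms s(2) X empty unfolding C_operator_def by (meson less_imp_le)
  with s t \<open>s < t / 2\<close> show False by auto
qed

lemma no_SC_operator_prevents_Y_wins_race: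
  assumes "SC_operator G"
  shows "\<exists>Y\<in>signals. Y_wins_race (G Y) Y"
proof (rule ccontr)
  assume "\<not> ?thesis"
  then have loses: "\<not> Y_wins_race (G Y) Y" if "Y \<in> signals" for Y
    using that by blast
  have empty: "{} \<in> signals"
    by (rule subset_singleton_in_signals[of 1]) auto
  \<comment> \<open>As \<open>{}\<close> is not disqualified, \<open>Y\<close> can lose with it only
    if \<open>G {}\<close> is not disqualified either.\<close>
  obtain t where t: "t > 0" "G {} \<inter> {0<..<t} = {}"
    using loses[OF empty] eventually_empty_at_0_empty
    unfolding Y_wins_race_def eventually_empty_at_0_def by blast
  let ?Y = "{t / 2}"
  have Y: "?Y \<in> signals"
    using t by (intro subset_singleton_in_signals[of "t / 2"]) auto
  \<comment> \<open>The case \<open>r = t / 2\<close> is included: strong causality compares inputs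
    only before \<open>r\<close>, so a tie is excluded.\<close>
  have "r \<notin> G ?Y" if r: "0 < r" "r \<le> t / 2" for r
  proof -
    have "\<forall>q\<in>{0..<r}. q \<in> ?Y \<longleftrightarrow> q \<in> {}"
      using r by auto
    then have "r \<in> G ?Y \<longleftrightarrow> r \<in> G {}"
      using assms r(1) Y empty unfolding SC_operator_def by (meson less_imp_le)
    then show ?thesis
      using r t by auto
  qed
  then have "Y_wins_race (G ?Y) ?Y"
    using t eventually_empty_at_0_singleton[of "t / 2"] unfolding Y_wins_race_def by auto
  with loses[OF Y] show False ..
qed

text \<open>In the following formulas the first-order variables 1 and 2 are reserved for bound
  variables.\<close>

definition Positive :: "nat \<Rightarrow> mso" where
  "Positive t = Ex1 2 (Less 2 t)"

definition Empty_before :: "nat \<Rightarrow> nat \<Rightarrow> mso" where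
  "Empty_before X t = All1 1 (Impl (Conj (Positive 1) (Less 1 t)) (Neg (Holds X 1)))"

definition Eventually_empty_at_0 :: "nat \<Rightarrow> mso" where
  "Eventually_empty_at_0 X = Ex1 0 (Conj (Positive 0) (Empty_before X 0))"

text \<open>\<open>Empty_before\<close> concerns an open interval; \<open>Neg (Holds 0 0)\<close>
  adds the right endpoint and thus the tie rule.\<close>

definition Race :: mso where
  "Race = Conj (Eventually_empty_at_0 1)
     (Impl (Eventually_empty_at_0 0)
       (Ex1 0 (Conj (Conj (Holds 1 0) (Positive 0))
         (Conj (Empty_before 0 0) (Neg (Holds 0 0))))))"

lemmas Race_defs = Race_def Eventually_empty_at_0_def Empty_before_def Positive_def

lemma formula2_Race: "formula2 Race"
  by (auto simp: formula2_def Race_defs)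

text \<open>Quantifiers range over \<open>{0..}\<close>, so 0 itself is the witness below a positive
  \<open>e t\<close>; \<open>t \<noteq> 2\<close> avoids capture.\<close>

lemma sat_Positive:
  assumes "t \<noteq> 2" "0 \<le> e t"
  shows "sat e E (Positive t) \<longleftrightarrow> 0 < e t"
  using assms by (auto simp: Positive_def)

lemma sat_Empty_before:
  assumes "t \<noteq> 1"
  shows "sat e E (Empty_before X t) \<longleftrightarrow> E X \<inter> {0<..<e t} = {}"
  using assms by (auto simp: Empty_before_def sat_Positive)

lemma sat_Eventually_empty_at_0:
  "sat e E (Eventually_empty_at_0 X) \<longleftrightarrow> eventually_empty_at_0 (E X)"
  by (auto simp: Eventually_empty_at_0_def eventually_empty_at_0_def sat_Positive
      sat_Empty_before intro: less_imp_le)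

lemma sat2_Race: "sat2 Race X Y \<longleftrightarrow> Y_wins_race X Y"
proof -
  have "X \<inter> {0<..s} = {} \<longleftrightarrow> X \<inter> {0<..<s} = {} \<and> s \<notin> X" if "0 < s" for s
    using that by (auto simp: order_le_less)
  then have "(\<exists>s\<in>{0..}. (s \<in> Y \<and> 0 < s) \<and> X \<inter> {0<..<s} = {} \<and> s \<notin> X) \<longleftrightarrow>
      (\<exists>s\<in>Y. 0 < s \<and> X \<inter> {0<..s} = {})"
    by (auto intro: less_imp_le)
  then show ?thesis
    by (simp add: sat2_def Race_def Y_wins_race_def sat_Eventually_empty_at_0 sat_Positive
        sat_Empty_before)
qed

theorem theorem1p2:
  "\<exists>\<psi>. formula2 \<psi> \<and>
     (\<nexists>F. C_operator F \<and> (\<forall>X\<in>signals. sat2 \<psi> X (F X))) \<and>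
     (\<nexists>G. SC_operator G \<and> (\<forall>Y\<in>signals. \<not> sat2 \<psi> (G Y) Y))"
  using formula2_Race no_C_operator_Y_wins_race no_SC_operator_prevents_Y_wins_race
  by (intro exI[of _ Race]) (auto simp: sat2_Race)

end
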